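(* Let $\mu$ be a discrete probability measure on $[0,1]$. For $N\in\mathbb{N}$ and points $y_1,\dots,y_N\in[0,1]$ let $\nu_N=\frac1N\sum_{k=1}^N\delta_{y_k}$. \begin{itemize} \item[(i)] (Finitely supported, rational weights.) Suppose $\mu=\sum_{i=1}^n \xi_i\delta_{x_i}$ with $0\le x_1<x_2<\dots<x_n\le 1$, where $\xi_i=\frac{p_i}{q_i}$ with $p_i,q_i\in\mathbb{N}$ and $\gcd(p_i,q_i)=1$. If $\operatorname{lcm}(q_1,\dots,q_{n-1})$ divides $N$, then there exists a point set $(y_k)_{k=1}^N$ with $D_N^*(\mu,\nu_N)=0$. Otherwise $D_N^*(\mu,\nu_N)\ge \frac{1}{qN}$ for all point sets $(y_k)_{k=1}^N$, where $q=\max(q_1,\dots,q_n)$. \item[(ii)] (Finitely supported, irrational weights.) Suppose $\mu=\sum_{i=1}^n \xi_i\delta_{x_i}$ with $0\le x_1<x_2<\dots<x_n\le 1$, $\xi_i\notin\mathbb{Q}$ for all $i$, and $\sum_{i=1}^l\xi_i\notin\mathbb{Q}$ for all $l=1,\dots,n-1$. Then for every $c>2$ there exist infinitely many $N\in\mathbb{N}$ such that $D_N^*(\mu,\nu_N)\ge\frac{1}{cN}$ for every point set $(y_k)_{k=1}^N$. \item[(iii)] (Infinitely supported.) Suppose $\mu=\sum_{i=1}^\infty \xi_i\delta_{x_i}$ with $x_i<x_{i+1}$ and $\xi_i>0$ for all $i\in\mathbb{N}$. Then there exists a constant $c\ge 2$ such that for infinitely many $N$, $D_N^*(\mu,\nu_N)\ge\frac{1}{cN}$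 holds for every point set $(y_k)_{k=1}^N$. If in addition $\sum_{i=1}^l\xi_i\notin\mathbb{Q}$ for all $l\in\mathbb{N}$, then $c>2$ can be chosen arbitrarily. \end{itemize}
   Context: For probability measures $\mu,\nu$ on $[0,1]$, the star-discrepancy is $D_N^*(\mu,\nu)=\sup_{A\in\mathcal{A}}|\mu(A)-\nu(A)|$, where $\mathcal{A}$ is the set of all half-open intervals in $[0,1]$ having one vertex at the origin (i.e. intervals $[0,a)$). $\delta_x$ denotes the Dirac measure at $x$. A discrete measure is one vanishing on the complement of a countable set. *)

theory Defs
  imports "HOL-Probability.Probability"
begin

abbreviation unit_borel :: "real measure" where
  "unit_borel \<equiv> restrict_space borel {0..1}"

definition discrete_measure :: "'a measure \<Rightarrow> bool" where
  "discrete_measure \<mu> \<longleftrightarrow>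
     (\<exists>C. countable C \<and> C \<in> sets \<mu> \<and> emeasure \<mu> (space \<mu> - C) = 0)"

text \<open>
  \<open>is_dirac_sum \<mu> I \<xi> x\<close> says that \<open>\<mu>\<close> is the sum of the measures
  \<open>\<xi>\<^sub>i \<delta>\<^bsub>x\<^sub>i\<^esub>\<close> over \<open>i \<in> I\<close>.
  The equation is stated setwise and with real values, so that it forces the weights at
  distinct points to be nonnegative; \<^const>\<open>ennreal\<close> would truncate negative weights to 0.
  For finite \<open>I\<close>, \<^const>\<open>has_sum\<close> is the ordinary finite sum.
\<close>
definition is_dirac_sum ::
    "real measure \<Rightarrow> nat set \<Rightarrow> (nat \<Rightarrow> real) \<Rightarrow> (nat \<Rightarrow> real) \<Rightarrow> bool" where
  "is_dirac_sum \<mu> I \<xi> x \<longleftrightarrow>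
     (\<forall>A\<in>sets \<mu>. ((\<lambda>i. \<xi> i * measure (return unit_borel (x i)) A) has_sum measure \<mu> A) I)"

definition empirical_measure :: "nat \<Rightarrow> (nat \<Rightarrow> real) \<Rightarrow> real measure" where
  "empirical_measure N y =
     measure_of {0..1} (sets unit_borel)
       (\<lambda>A. ennreal (1 / real N) * (\<Sum>k=1..N. emeasure (return unit_borel (y k)) A))"

definition anchored_intervals :: "real set set" where
  "anchored_intervals = {{0..<a} | a. 0 \<le> a \<and> a \<le> 1}"

definition star_discrepancy :: "real measure \<Rightarrow> real measure \<Rightarrow> real" where
  "star_discrepancy \<mu> \<nu> = (SUP A\<in>anchored_intervals. \<bar>measure \<mu> A - measure \<nu> A\<bar>)"

definition point_set :: "nat \<Rightarrow> (nat \<Rightarrow> real) \<Rightarrow> bool" where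
  "point_set N y \<longleftrightarrow> (\<forall>k\<in>{1..N}. y k \<in> {0..1})"

lemma sets_empirical_measure [simp]: "sets (empirical_measure N y) = sets unit_borel"
  and space_empirical_measure [simp]: "space (empirical_measure N y) = {0..1}"
proof -
  have "sets unit_borel \<subseteq> Pow {0..1}" "sigma_sets {0..1} (sets unit_borel) = sets unit_borel"
    using sets.space_closed[of unit_borel] sets.sigma_sets_eq[of unit_borel]
    by (simp_all add: space_restrict_space)
  then show "sets (empirical_measure N y) = sets unit_borel"
    "space (empirical_measure N y) = {0..1}"
    unfolding empirical_measure_def by (simp_all add: sets_measure_of space_measure_of)
qed

lemma emeasure_empirical_measure:
  assumes A: "A \<in> sets unit_borel"
  shows "emeasure (empirical_measure N y) A =
    ennreal (1 / real N) * (\<Sum>k=1..N. emeasure (return unit_borel (y k)) A)"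
proof (rule emeasure_measure_of[OF empirical_measure_def])
  show "sets unit_borel \<subseteq> Pow {0..1}"
    using sets.space_closed[of unit_borel] by (simp add: space_restrict_space)
  show "A \<in> sets (empirical_measure N y)" using A by simp
  show "positive (sets (empirical_measure N y))
     (\<lambda>A. ennreal (1 / real N) * (\<Sum>k=1..N. emeasure (return unit_borel (y k)) A))"
    by (simp add: positive_def)
  show "countably_additive (sets (empirical_measure N y))
     (\<lambda>A. ennreal (1 / real N) * (\<Sum>k=1..N. emeasure (return unit_borel (y k)) A))"
  proof (rule countably_additiveI)
    fix B :: "nat \<Rightarrow> real set"
    assume B: "range B \<subseteq> sets (empirical_measure N y)" "disjoint_family B"
    have "(\<Sum>i. emeasure (return unit_borel (y k)) (B i)) =
      emeasure (return unit_borel (y k)) (\<Union>i. B i)" for k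
      by (rule suminf_emeasure) (use B in auto)
    then show "(\<Sum>i. ennreal (1 / real N) *
        (\<Sum>k=1..N. emeasure (return unit_borel (y k)) (B i))) =
      ennreal (1 / real N) * (\<Sum>k=1..N. emeasure (return unit_borel (y k)) (\<Union>i. B i))"
      by (simp add: suminf_sum)
  qed
qed

end

theory Submission
  imports Defs "HOL-Analysis.Kronecker_Approximation_Theorem"
begin

text \<open>
  The empirical measure gives every interval a mass in \<open>\<int> / N\<close>, so the discrepancy is at least
  the distance of \<open>\<mu> [0, a)\<close> to \<open>\<int> / N\<close>.  Choosing for \<open>a\<close> the next atom makes \<open>\<mu> [0, a)\<close> a
  partial sum of the weights.  For rational weights take the partial sum up to the first \<open>i\<close> with
  \<open>q\<^sub>i\<close> not dividing \<open>N\<close>; if there is no such \<open>i < n\<close>, all \<open>N \<xi>\<^sub>i\<close> are integers, since they sum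
  to \<open>N\<close>, and \<open>N \<xi>\<^sub>i\<close> points at each \<open>x\<^sub>i\<close> reproduce \<open>\<mu>\<close>.  For an irrational first weight \<open>\<xi>\<^sub>1\<close>,
  Kronecker's theorem brings \<open>N \<xi>\<^sub>1\<close> as close to a half-integer as desired for infinitely many \<open>N\<close>.
  In (iii), a rational \<open>\<xi>\<^sub>1 \<in> (0, 1)\<close> with denominator \<open>q\<close> leaves the bound \<open>1 / (q N)\<close> for
  every \<open>N\<close> congruent to 1 modulo \<open>q\<close>.
\<close>

lemma infdist_Ints_ge_inverse_denominator:
  fixes t :: real
  assumes "q > 0" "real q * t \<in> \<int>" "t \<notin> \<int>"
  shows "1 / real q \<le> infdist t \<int>"
proof -
  have "1 / real q \<le> dist t z" if "z \<in> \<int>" for z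
  proof -
    have "real q * (t - z) \<in> \<int>"
      using assms(2) that by (simp add: right_diff_distrib)
    moreover have "real q * (t - z) \<noteq> 0"
      using assms that by auto
    ultimately have "1 \<le> \<bar>real q * (t - z)\<bar>"
      by (rule Ints_nonzero_abs_ge1)
    then have "1 \<le> real q * dist t z"
      by (simp add: dist_real_def abs_mult)
    with \<open>q > 0\<close> show ?thesis
      by (simp add: field_simps)
  qed
  moreover have "(\<int> :: real set) \<noteq> {}"
    using Ints_0 by blast
  ultimately show ?thesis
    by (simp add: infdist_notempty cINF_greatest)
qed

lemma infinite_multiples_near_half_integer:
  fixes \<theta> \<epsilon> :: real
  assumes "\<theta> \<notin> \<rat>" "\<epsilon> > 0"
  shows "infinite {N. 1/2 - \<epsilon> \<le> infdist (real N * \<theta>) \<int>}"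
  unfolding infinite_nat_iff_unbounded
proof
  fix L :: nat
  \<comment> \<open>Kronecker's theorem yields a single multiple of its argument; applied to
    \<open>(L + 1) \<theta>\<close> that multiple is \<open>N \<theta>\<close> with \<open>N > L\<close>.\<close>
  have "real (Suc L) * \<theta> \<notin> \<rat>"
  proof
    assume "real (Suc L) * \<theta> \<in> \<rat>"
    then have "real (Suc L) * \<theta> / real (Suc L) \<in> \<rat>"
      by (intro Rats_divide Rats_of_nat)
    with \<open>\<theta> \<notin> \<rat>\<close> show False
      by simp
  qed
  from Kronecker_approx_1_explicit[OF this, of "1/2" \<epsilon>] \<open>\<epsilon> > 0\<close>
  obtain m :: nat where "m > 0" and near_half: "\<bar>frac (real m * (real (Suc L) * \<theta>)) - 1/2\<bar> < \<epsilon>"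
    by auto
  define N where "N = m * Suc L"
  have multiple: "real m * (real (Suc L) * \<theta>) = real N * \<theta>"
    by (simp only: N_def of_nat_mult mult.assoc)
  define half where "half = of_int \<lfloor>real N * \<theta>\<rfloor> + (1/2 :: real)"
  have "(1/2 :: real) \<notin> \<int>"
    using fraction_not_in_Ints[of 2 1, where 'a = real] by simp
  then have "1/2 \<le> infdist half \<int>"
    using infdist_Ints_ge_inverse_denominator[of 2 half] by (simp add: half_def distrib_left)
  also have "\<dots> \<le> infdist (real N * \<theta>) \<int> + dist half (real N * \<theta>)"
    by (rule infdist_triangle)
  also have "dist half (real N * \<theta>) < \<epsilon>"
    using near_half unfolding multiple by (simp add: half_def dist_real_def frac_def)
  finally have "1/2 - \<epsilon> \<le> infdist (real N * \<theta>) \<int>"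
    by simp
  moreover have "N > L"
    using mult_le_mono1[of 1 m "Suc L"] \<open>m > 0\<close> by (simp add: N_def)
  ultimately show "\<exists>N>L. N \<in> {N. 1/2 - \<epsilon> \<le> infdist (real N * \<theta>) \<int>}"
    by blast
qed

lemma infinite_multiples_far_from_Ints_of_denominator:
  fixes \<theta> :: real
  assumes "q > 0" "real q * \<theta> \<in> \<int>" "\<theta> \<notin> \<int>"
  shows "infinite {N. 1 / real q \<le> infdist (real N * \<theta>) \<int>}"
  unfolding infinite_nat_iff_unbounded
proof
  fix L :: nat
  let ?N = "L * q + 1"
  have "1 / real q \<le> infdist (real ?N * \<theta>) \<int>"
  proof (rule infdist_Ints_ge_inverse_denominator[OF \<open>q > 0\<close>])
    have shift: "real ?N * \<theta> = real L * (real q * \<theta>) + \<theta>"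
      by (simp add: algebra_simps)
    have "real L * (real q * \<theta>) \<in> \<int>"
      by (rule Ints_mult[OF Ints_of_nat assms(2)])
    with assms(3) show "real ?N * \<theta> \<notin> \<int>"
      by (simp only: shift add_in_Ints_iff_left not_False_eq_True)
    have "real ?N * (real q * \<theta>) \<in> \<int>"
      by (rule Ints_mult[OF Ints_of_nat assms(2)])
    then show "real q * (real ?N * \<theta>) \<in> \<int>"
      by (simp only: mult.left_commute)
  qed
  moreover have "?N > L"
    using \<open>q > 0\<close> by (simp add: less_Suc_eq_le)
  ultimately show "\<exists>N>L. N \<in> {N. 1 / real q \<le> infdist (real N * \<theta>) \<int>}"
    by (intro exI[of _ ?N] conjI CollectI)
qed

lemma infinite_multiples_far_from_Ints:
  fixes \<theta> :: real
  assumes "\<theta> \<notin> \<int>"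
  shows "\<exists>c\<ge>2. infinite {N. 1 / c \<le> infdist (real N * \<theta>) \<int>}"
proof (cases "\<theta> \<in> \<rat>")
  case True
  then obtain a b where "b > 0" and fraction: "\<theta> = of_int a / of_int b"
    by (rule Rats_cases')
  define q where "q = nat b"
  have "q > 0" and denominator: "real q * \<theta> \<in> \<int>"
    using \<open>b > 0\<close> by (simp_all add: q_def fraction)
  moreover have "q \<noteq> 1"
    using denominator assms by (metis mult_1 of_nat_1)
  ultimately have "real q \<ge> 2"
    by simp
  then show ?thesis
    using infinite_multiples_far_from_Ints_of_denominator[OF \<open>q > 0\<close> denominator assms] by blast
next
  case False
  then show ?thesis
    using infinite_multiples_near_half_integer[of \<theta> "1/6"] by (intro exI[of _ 3]) simp
qed

lemma of_nat_mult_fraction_in_Ints_iff: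
  assumes "coprime p q" "q > 0"
  shows "real N * (real p / real q) \<in> \<int> \<longleftrightarrow> q dvd N"
proof -
  have "real N * (real p / real q) = of_int (int (N * p)) / of_int (int q)"
    by simp
  also have "\<dots> \<in> \<int> \<longleftrightarrow> q dvd N * p"
    using \<open>q > 0\<close> by (simp only: of_int_div_of_int_in_Ints_iff int_dvd_int_iff) simp
  also have "\<dots> \<longleftrightarrow> q dvd N"
    using assms(1) by (simp add: coprime_commute coprime_dvd_mult_left_iff)
  finally show ?thesis .
qed

lemma Lcm_denominators_dvd_iff:
  assumes "\<forall>i\<in>J. q i \<ge> 1 \<and> coprime (p i) (q i) \<and> \<xi> i = real (p i) / real (q i)"
  shows "Lcm (q ` J) dvd N \<longleftrightarrow> (\<forall>i\<in>J. real N * \<xi> i \<in> \<int>)"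
proof -
  have "real N * \<xi> i \<in> \<int> \<longleftrightarrow> q i dvd N" if "i \<in> J" for i
  proof -
    have "q i > 0" "coprime (p i) (q i)" "\<xi> i = real (p i) / real (q i)"
      using assms that by (auto simp: Suc_le_eq)
    then show ?thesis
      by (simp only: of_nat_mult_fraction_in_Ints_iff)
  qed
  then show ?thesis
    by (simp add: Lcm_dvd_iff)
qed

lemma strict_mono_on_atLeastI:
  fixes f :: "nat \<Rightarrow> 'a::order"
  assumes "\<And>i. i \<ge> m \<Longrightarrow> f i < f (Suc i)"
  shows "strict_mono_on {m..} f"
proof (rule strict_mono_onI)
  fix i j assume "i \<in> {m..}" "i < j"
  then have "{i..<j} \<subseteq> {m..}"
    by auto
  with \<open>i < j\<close> show "f i < f j"
    by (rule lift_Suc_mono_less_ivl[of "{m..}" f, rotated]) (simp add: assms)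
qed

lemma exists_map_with_fibre_cards:
  fixes m :: "'a \<Rightarrow> nat"
  assumes "finite K" "finite I" "card K = sum m I"
  obtains f where "f \<in> K \<rightarrow> I" "\<And>J. J \<subseteq> I \<Longrightarrow> card {k\<in>K. f k \<in> J} = sum m J"
proof -
  define S where "S = (SIGMA i:I. {..<m i})"
  have "finite S" "card K = card S"
    using assms by (simp_all add: S_def)
  then obtain h where bij: "bij_betw h K S"
    using finite_same_card_bij \<open>finite K\<close> by blast
  show thesis
  proof
    show "fst \<circ> h \<in> K \<rightarrow> I"
      using bij_betwE[OF bij] by (auto simp: S_def)
    fix J assume "J \<subseteq> I"
    have "h ` {k\<in>K. (fst \<circ> h) k \<in> J} = {s\<in>S. fst s \<in> J}"
      using bij_betw_imp_surj_on[OF bij] by force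
    also have "\<dots> = (SIGMA i:J. {..<m i})"
      using \<open>J \<subseteq> I\<close> by (auto simp: S_def)
    finally have "card (h ` {k\<in>K. (fst \<circ> h) k \<in> J}) = sum m J"
      using finite_subset[OF \<open>J \<subseteq> I\<close> \<open>finite I\<close>] by simp
    moreover have "inj_on h {k\<in>K. (fst \<circ> h) k \<in> J}"
      using bij_betw_imp_inj_on[OF bij] by (rule inj_on_subset) auto
    ultimately show "card {k\<in>K. (fst \<circ> h) k \<in> J} = sum m J"
      by (simp add: card_image)
  qed
qed

lemma anchored_interval_in_sets:
  "A \<in> anchored_intervals \<Longrightarrow> A \<in> sets unit_borel"
  by (auto simp: anchored_intervals_def sets_restrict_space_iff)

lemma anchored_intervals_nonempty: "anchored_intervals \<noteq> {}"
proof -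
  have "{0..<0} \<in> anchored_intervals"
    unfolding anchored_intervals_def by (intro CollectI exI[of _ 0]) simp
  then show ?thesis
    by blast
qed

lemma star_discrepancy_self: "star_discrepancy \<mu> \<mu> = 0"
  by (simp add: star_discrepancy_def anchored_intervals_nonempty)

lemma abs_measure_diff_le_star_discrepancy:
  assumes "finite_measure \<mu>" "finite_measure \<nu>" "A \<in> anchored_intervals"
  shows "\<bar>measure \<mu> A - measure \<nu> A\<bar> \<le> star_discrepancy \<mu> \<nu>"
  unfolding star_discrepancy_def
proof (rule cSUP_upper[OF assms(3)], rule bdd_aboveI2)
  fix B :: "real set"
  have "measure \<mu> B \<le> measure \<mu> (space \<mu>)" "measure \<nu> B \<le> measure \<nu> (space \<nu>)"
    using assms(1,2) by (simp_all add: finite_measure.bounded_measure)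
  then show "\<bar>measure \<mu> B - measure \<nu> B\<bar> \<le> measure \<mu> (space \<mu>) + measure \<nu> (space \<nu>)"
    using measure_nonneg[of \<mu> B] measure_nonneg[of \<nu> B] by linarith
qed

lemma measure_empirical_measure:
  assumes "A \<in> sets unit_borel"
  shows "measure (empirical_measure N y) A = real (card {k\<in>{1..N}. y k \<in> A}) / real N"
proof -
  have "(\<Sum>k=1..N. emeasure (return unit_borel (y k)) A) = (\<Sum>k=1..N. indicator A (y k))"
    using assms by (intro sum.cong) (auto simp: emeasure_return)
  also have "\<dots> = (\<Sum>k | k \<in> {1..N} \<and> y k \<in> A. 1)"
    by (intro sum.mono_neutral_cong_right) auto
  finally have "emeasure (empirical_measure N y) A =
      ennreal (1 / real N) * of_nat (card {k\<in>{1..N}. y k \<in> A})"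
    using assms by (simp only: emeasure_empirical_measure) simp
  then show ?thesis
    by (simp add: measure_def enn2real_mult)
qed

lemma finite_measure_empirical_measure: "finite_measure (empirical_measure N y)"
proof (rule finite_measureI)
  have "{0..1} \<in> sets unit_borel"
    by (simp add: sets_restrict_space_iff)
  then have "emeasure (empirical_measure N y) {0..1} =
      ennreal (1 / real N) * (\<Sum>k=1..N. indicator {0..1} (y k))"
    by (simp only: emeasure_empirical_measure emeasure_return)
  then show "emeasure (empirical_measure N y) (space (empirical_measure N y)) \<noteq> \<infinity>"
    by (auto simp: ennreal_mult_eq_top_iff split: split_indicator)
qed

lemma star_discrepancy_empirical_measure_ge:
  assumes "finite_measure \<mu>" "N \<ge> 1" "a \<in> {0..1}"
  shows "infdist (real N * measure \<mu> {0..<a}) \<int> / real N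
      \<le> star_discrepancy \<mu> (empirical_measure N y)"
proof -
  let ?t = "measure \<mu> {0..<a}" and ?m = "card {k\<in>{1..N}. y k \<in> {0..<a}}"
  have anchored: "{0..<a} \<in> anchored_intervals"
    using assms(3) by (auto simp: anchored_intervals_def)
  have "infdist (real N * ?t) \<int> / real N \<le> dist (real N * ?t) (real ?m) / real N"
    by (intro divide_right_mono infdist_le Ints_of_nat) simp
  also have "\<dots> = \<bar>?t - real ?m / real N\<bar>"
  proof -
    have "real N * ?t - real ?m = real N * (?t - real ?m / real N)"
      using \<open>N \<ge> 1\<close> by (simp add: field_simps)
    then show ?thesis
      using \<open>N \<ge> 1\<close> by (simp add: dist_real_def abs_mult)
  qed
  also have "\<dots> = \<bar>?t - measure (empirical_measure N y) {0..<a}\<bar>"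
    using anchored_interval_in_sets[OF anchored] by (simp only: measure_empirical_measure)
  also have "\<dots> \<le> star_discrepancy \<mu> (empirical_measure N y)"
    using assms(1) finite_measure_empirical_measure anchored
    by (rule abs_measure_diff_le_star_discrepancy)
  finally show ?thesis .
qed

definition poorly_approximated_sizes :: "real measure \<Rightarrow> real \<Rightarrow> nat set" where
  "poorly_approximated_sizes \<mu> c = {N. N \<ge> 1 \<and> (\<forall>y. point_set N y \<longrightarrow>
     star_discrepancy \<mu> (empirical_measure N y) \<ge> 1 / (c * real N))}"

lemma infinite_poorly_approximated_sizes:
  assumes "finite_measure \<mu>" "a \<in> {0..1}" "c > 0"
    and "infinite {N. 1 / c \<le> infdist (real N * measure \<mu> {0..<a}) \<int>}"
  shows "infinite (poorly_approximated_sizes \<mu> c)"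
proof -
  have "N \<in> poorly_approximated_sizes \<mu> c"
    if far: "1 / c \<le> infdist (real N * measure \<mu> {0..<a}) \<int>" for N
  proof -
    have "N \<noteq> 0"
    proof
      assume "N = 0"
      with far \<open>c > 0\<close> show False
        by simp
    qed
    then have "N \<ge> 1"
      by simp
    have "1 / c / real N \<le> star_discrepancy \<mu> (empirical_measure N y)" for y
      using divide_right_mono[OF far, of "real N"]
        star_discrepancy_empirical_measure_ge[OF assms(1) \<open>N \<ge> 1\<close> assms(2), of y]
      by linarith
    with \<open>N \<ge> 1\<close> show ?thesis
      by (simp add: poorly_approximated_sizes_def)
  qed
  then show ?thesis
    by (intro infinite_super[OF _ assms(4)] subsetI) simp
qed

lemma infinite_poorly_approximated_sizes_of_irrational:
  assumes "finite_measure \<mu>" "a \<in> {0..1}" "measure \<mu> {0..<a} \<notin> \<rat>" "c > 2"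
  shows "infinite (poorly_approximated_sizes \<mu> c)"
proof (rule infinite_poorly_approximated_sizes[OF assms(1,2)])
  have "1/2 - 1/c > 0"
    using \<open>c > 2\<close> by (simp add: field_simps)
  then show "infinite {N. 1 / c \<le> infdist (real N * measure \<mu> {0..<a}) \<int>}"
    using infinite_multiples_near_half_integer[OF assms(3), of "1/2 - 1/c"] by simp
qed (use \<open>c > 2\<close> in simp)

lemma infinite_poorly_approximated_sizes_of_nonint:
  assumes "finite_measure \<mu>" "a \<in> {0..1}" "measure \<mu> {0..<a} \<notin> \<int>"
  shows "\<exists>c\<ge>2. infinite (poorly_approximated_sizes \<mu> c)"
proof -
  obtain c where "c \<ge> 2" "infinite {N. 1 / c \<le> infdist (real N * measure \<mu> {0..<a}) \<int>}"
    using infinite_multiples_far_from_Ints[OF assms(3)] by blast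
  then show ?thesis
    using infinite_poorly_approximated_sizes[OF assms(1,2), of c] by auto
qed

locale ordered_dirac_sum = prob_space \<mu> for \<mu> :: "real measure" +
  fixes I :: "nat set" and \<xi> x :: "nat \<Rightarrow> real"
  assumes sets_eq_unit_borel: "sets \<mu> = sets unit_borel"
    and dirac_sum: "is_dirac_sum \<mu> I \<xi> x"
    and strict_mono_atoms: "strict_mono_on I x"
    and atom_in_unit: "\<And>i. i \<in> I \<Longrightarrow> x i \<in> {0..1}"
begin

lemma measure_eq_sum_weights:
  assumes "A \<in> sets unit_borel" "finite {i\<in>I. x i \<in> A}"
  shows "measure \<mu> A = (\<Sum>i | i \<in> I \<and> x i \<in> A. \<xi> i)"
proof -
  have "((\<lambda>i. \<xi> i * measure (return unit_borel (x i)) A) has_sum measure \<mu> A) I"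
    using dirac_sum assms(1) sets_eq_unit_borel unfolding is_dirac_sum_def by blast
  moreover have "((\<lambda>i. \<xi> i * measure (return unit_borel (x i)) A) has_sum measure \<mu> A) I
      \<longleftrightarrow> (\<xi> has_sum measure \<mu> A) {i\<in>I. x i \<in> A}"
    using assms(1) by (intro has_sum_cong_neutral) (auto simp: measure_return)
  ultimately show ?thesis
    using has_sum_unique has_sum_finite[OF assms(2)] by blast
qed

lemma sum_weights_eq_1:
  assumes "finite I"
  shows "sum \<xi> I = 1"
proof -
  have "space \<mu> = {0..1}"
    using sets_eq_imp_space_eq[OF sets_eq_unit_borel] by (simp add: space_restrict_space)
  moreover have "measure \<mu> {0..1} = (\<Sum>i | i \<in> I \<and> x i \<in> {0..1}. \<xi> i)"
    using assms by (intro measure_eq_sum_weights) (simp_all add: sets_restrict_space_iff)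
  moreover have "{i\<in>I. x i \<in> {0..1}} = I"
    using atom_in_unit by blast
  ultimately show ?thesis
    using prob_space by simp
qed

lemma measure_atoms:
  assumes "finite J" "J \<subseteq> I"
  shows "measure \<mu> (x ` J) = sum \<xi> J"
proof -
  have "{i\<in>I. x i \<in> x ` J} = J"
    using assms(2) inj_onD[OF strict_mono_on_imp_inj_on[OF strict_mono_atoms]] by blast
  moreover have "x ` J \<in> sets unit_borel"
    using assms atom_in_unit by (auto simp: sets_restrict_space_iff finite_imp_closed)
  ultimately show ?thesis
    using measure_eq_sum_weights[of "x ` J"] assms(1) by simp
qed

lemma weight_nonneg: "i \<in> I \<Longrightarrow> 0 \<le> \<xi> i"
  using measure_atoms[of "{i}"] measure_nonneg[of \<mu> "{x i}"] by simp

lemma sum_weights_le_1: "finite J \<Longrightarrow> J \<subseteq> I \<Longrightarrow> sum \<xi> J \<le> 1"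
  using measure_atoms prob_le_1 by metis

lemma measure_below_atom:
  assumes "j \<in> I"
  shows "measure \<mu> {0..<x j} = (\<Sum>i | i \<in> I \<and> i < j. \<xi> i)"
proof -
  have "{0..<x j} \<in> anchored_intervals"
    using atom_in_unit[OF assms] by (auto simp: anchored_intervals_def)
  moreover have "{i\<in>I. x i \<in> {0..<x j}} = {i\<in>I. i < j}"
    using strict_mono_on_less[OF strict_mono_atoms _ assms] atom_in_unit by auto
  ultimately show ?thesis
    using measure_eq_sum_weights[of "{0..<x j}"] anchored_interval_in_sets by simp
qed

lemma exists_atom_above_first_weight:
  assumes "i \<in> I" "\<And>k. k \<in> I \<Longrightarrow> i \<le> k" "\<xi> i \<noteq> 1"
  obtains j where "j \<in> I" "measure \<mu> {0..<x j} = \<xi> i"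
proof -
  have "I \<noteq> {i}"
    using sum_weights_eq_1 assms(3) by auto
  then have ex: "\<exists>j. j \<in> I - {i}"
    using assms(1) by blast
  define j where "j = (LEAST j. j \<in> I - {i})"
  have j: "j \<in> I - {i}"
    unfolding j_def using ex by (rule LeastI_ex)
  have least: "j \<le> k" if "k \<in> I - {i}" for k
    unfolding j_def using that by (rule Least_le)
  have "i < j"
    using assms(2)[of j] j by auto
  have "{k\<in>I. k < j} = {i}"
    using \<open>i < j\<close> assms(1) least by (auto simp flip: not_le)
  then show thesis
    using that[of j] measure_below_atom[of j] j by simp
qed

lemma exists_empirical_measure_eq_of_nat_multiples:
  assumes "finite I" "N \<ge> 1" and mult_weight: "\<And>i. i \<in> I \<Longrightarrow> real (m i) = real N * \<xi> i"
  shows "\<exists>y. point_set N y \<and> empirical_measure N y = \<mu>"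
proof -
  have "real (sum m I) = real N * sum \<xi> I"
    using mult_weight by (simp add: sum_distrib_left)
  then have "card {1..N} = sum m I"
    using sum_weights_eq_1[OF assms(1)] by (simp del: of_nat_sum)
  then obtain f where range: "f \<in> {1..N} \<rightarrow> I"
      and fibres: "\<And>J. J \<subseteq> I \<Longrightarrow> card {k\<in>{1..N}. f k \<in> J} = sum m J"
    using exists_map_with_fibre_cards[OF _ assms(1)] by blast
  let ?\<nu> = "empirical_measure N (x \<circ> f)"
  have "emeasure ?\<nu> A = emeasure \<mu> A" if "A \<in> sets ?\<nu>" for A
  proof -
    have A_sets: "A \<in> sets unit_borel"
      using that by (simp only: sets_empirical_measure)
    define J where "J = {i\<in>I. x i \<in> A}"
    have "{k\<in>{1..N}. (x \<circ> f) k \<in> A} = {k\<in>{1..N}. f k \<in> J}"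
      using range by (auto simp: J_def)
    then have "real (card {k\<in>{1..N}. (x \<circ> f) k \<in> A}) = real (sum m J)"
      using fibres[of J] by (simp add: J_def)
    also have "\<dots> = real N * sum \<xi> J"
      using mult_weight by (simp add: sum_distrib_left J_def)
    also have "sum \<xi> J = measure \<mu> A"
      using measure_eq_sum_weights[OF A_sets] assms(1) by (simp add: J_def)
    finally have "measure ?\<nu> A = measure \<mu> A"
      using \<open>N \<ge> 1\<close> by (simp only: measure_empirical_measure[OF A_sets]) simp
    then show ?thesis
      using finite_measure.emeasure_eq_measure[OF finite_measure_empirical_measure]
      by (simp only: emeasure_eq_measure)
  qed
  then have "?\<nu> = \<mu>"
    by (intro measure_eqI) (simp_all add: sets_eq_unit_borel)
  moreover have "point_set N (x \<circ> f)"
    using range atom_in_unit by (auto simp: point_set_def)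
  ultimately show ?thesis
    by blast
qed

lemma multiple_of_weight_in_Ints_if_others:
  assumes "finite I" "j \<in> I" "\<And>i. i \<in> I - {j} \<Longrightarrow> real N * \<xi> i \<in> \<int>"
  shows "real N * \<xi> j \<in> \<int>"
proof -
  have "\<xi> j + sum \<xi> (I - {j}) = 1"
    using sum_weights_eq_1 sum.remove[OF assms(1,2), of \<xi>] assms(1) by simp
  then have "\<xi> j = 1 - sum \<xi> (I - {j})"
    by simp
  then have "real N * \<xi> j = real N - (\<Sum>i\<in>I - {j}. real N * \<xi> i)"
    by (simp add: right_diff_distrib sum_distrib_left)
  also have "\<dots> \<in> \<int>"
    using assms(3) by (intro Ints_diff Ints_of_nat Ints_sum)
  finally show ?thesis .
qed

lemma exists_empirical_measure_eq_of_int_multiples: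
  assumes "finite I" "N \<ge> 1" "j \<in> I"
    and others: "\<And>i. i \<in> I - {j} \<Longrightarrow> real N * \<xi> i \<in> \<int>"
  shows "\<exists>y. point_set N y \<and> empirical_measure N y = \<mu>"
proof (rule exists_empirical_measure_eq_of_nat_multiples[OF assms(1,2)])
  fix i assume "i \<in> I"
  then have "real N * \<xi> i \<in> \<int>"
    using others multiple_of_weight_in_Ints_if_others[OF assms(1,3) others] by blast
  then show "real (nat \<lfloor>real N * \<xi> i\<rfloor>) = real N * \<xi> i"
    using weight_nonneg[OF \<open>i \<in> I\<close>] by simp
qed

lemma star_discrepancy_ge_at_first_nonint_multiple:
  assumes "l \<in> I" "Suc l \<in> I" "N \<ge> 1"
    and "q > 0" "real q * \<xi> l \<in> \<int>" "real N * \<xi> l \<notin> \<int>"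
    and before: "\<And>i. i \<in> I \<Longrightarrow> i < l \<Longrightarrow> real N * \<xi> i \<in> \<int>"
  shows "1 / (real q * real N) \<le> star_discrepancy \<mu> (empirical_measure N y)"
proof -
  let ?z = "\<Sum>i | i \<in> I \<and> i < l. real N * \<xi> i"
  have partial_sum_int: "?z \<in> \<int>"
    using before by (intro Ints_sum) simp
  have "{i\<in>I. i < Suc l} = insert l {i\<in>I. i < l}"
    using \<open>l \<in> I\<close> by auto
  then have mass: "real N * measure \<mu> {0..<x (Suc l)} = ?z + real N * \<xi> l"
    using measure_below_atom[OF \<open>Suc l \<in> I\<close>] by (simp add: sum_distrib_left algebra_simps)
  have "real q * (?z + real N * \<xi> l) = real q * ?z + real N * (real q * \<xi> l)"
    by (simp add: algebra_simps)
  also have "\<dots> \<in> \<int>"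
    by (intro Ints_add Ints_mult[OF Ints_of_nat partial_sum_int] Ints_mult[OF Ints_of_nat assms(5)])
  finally have "1 / real q \<le> infdist (real N * measure \<mu> {0..<x (Suc l)}) \<int>"
    unfolding mass using \<open>q > 0\<close> partial_sum_int assms(6)
    by (intro infdist_Ints_ge_inverse_denominator) simp_all
  then have "1 / real q / real N \<le> infdist (real N * measure \<mu> {0..<x (Suc l)}) \<int> / real N"
    by (rule divide_right_mono) simp
  also have "\<dots> \<le> star_discrepancy \<mu> (empirical_measure N y)"
    using finite_measure_axioms \<open>N \<ge> 1\<close> atom_in_unit[OF \<open>Suc l \<in> I\<close>]
    by (rule star_discrepancy_empirical_measure_ge)
  finally show ?thesis
    by simp
qed

lemma star_discrepancy_ge_of_nonint_multiple:
  assumes "I = {1..n}" "N \<ge> 1" "j \<in> {1..n-1}" "real N * \<xi> j \<notin> \<int>"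
    and denominators: "\<And>i. i \<in> {1..n} \<Longrightarrow> q i > 0 \<and> real (q i) * \<xi> i \<in> \<int>"
  shows "1 / (real (Max (q ` {1..n})) * real N) \<le> star_discrepancy \<mu> (empirical_measure N y)"
proof -
  define l where "l = (LEAST i. i \<in> I \<and> real N * \<xi> i \<notin> \<int>)"
  have "j \<in> I \<and> real N * \<xi> j \<notin> \<int>"
    using assms(1,3,4) by auto
  then have "l \<in> I" and nonint: "real N * \<xi> l \<notin> \<int>" and "l \<le> j"
    using LeastI[of "\<lambda>i. i \<in> I \<and> real N * \<xi> i \<notin> \<int>"]
      Least_le[of "\<lambda>i. i \<in> I \<and> real N * \<xi> i \<notin> \<int>"] unfolding l_def by blast+
  have before: "real N * \<xi> i \<in> \<int>" if "i \<in> I" "i < l" for i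
    using not_less_Least[of i "\<lambda>i. i \<in> I \<and> real N * \<xi> i \<notin> \<int>"] that by (simp add: l_def)
  have "Suc l \<in> I"
    using \<open>l \<in> I\<close> \<open>l \<le> j\<close> assms(1,3) by auto
  have denominator: "q l > 0" "real (q l) * \<xi> l \<in> \<int>"
    using denominators \<open>l \<in> I\<close> assms(1) by auto
  have "q l \<le> Max (q ` {1..n})"
    using \<open>l \<in> I\<close> assms(1) by (intro Max_ge) auto
  then have "1 / (real (Max (q ` {1..n})) * real N) \<le> 1 / (real (q l) * real N)"
    using denominator(1) \<open>N \<ge> 1\<close> by (intro divide_left_mono mult_right_mono mult_pos_pos) auto
  also have "\<dots> \<le> star_discrepancy \<mu> (empirical_measure N y)"
    using \<open>l \<in> I\<close> \<open>Suc l \<in> I\<close> \<open>N \<ge> 1\<close> denominator nonint before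
    by (rule star_discrepancy_ge_at_first_nonint_multiple)
  finally show ?thesis .
qed

lemma exists_zero_star_discrepancy_of_Lcm_dvd:
  assumes "I = {1..n}" "n \<ge> 1" "N \<ge> 1"
    and weights: "\<forall>i\<in>{1..n}. q i \<ge> 1 \<and> coprime (p i) (q i) \<and> \<xi> i = real (p i) / real (q i)"
    and "Lcm (q ` {1..n-1}) dvd N"
  shows "\<exists>y. point_set N y \<and> star_discrepancy \<mu> (empirical_measure N y) = 0"
proof -
  have "Lcm (q ` {1..n-1}) dvd N \<longleftrightarrow> (\<forall>i\<in>{1..n-1}. real N * \<xi> i \<in> \<int>)"
    using weights by (intro Lcm_denominators_dvd_iff) auto
  then have "real N * \<xi> i \<in> \<int>" if "i \<in> I - {n}" for i
    using that assms(1,5) by auto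
  then obtain y where "point_set N y" "empirical_measure N y = \<mu>"
    using exists_empirical_measure_eq_of_int_multiples[of N n] assms(1-3) by auto
  then show ?thesis
    using star_discrepancy_self by metis
qed

lemma star_discrepancy_ge_of_not_Lcm_dvd:
  assumes "I = {1..n}" "N \<ge> 1"
    and weights: "\<forall>i\<in>{1..n}. q i \<ge> 1 \<and> coprime (p i) (q i) \<and> \<xi> i = real (p i) / real (q i)"
    and "\<not> Lcm (q ` {1..n-1}) dvd N"
  shows "1 / (real (Max (q ` {1..n})) * real N) \<le> star_discrepancy \<mu> (empirical_measure N y)"
proof -
  have "Lcm (q ` {1..n-1}) dvd N \<longleftrightarrow> (\<forall>i\<in>{1..n-1}. real N * \<xi> i \<in> \<int>)"
    using weights by (intro Lcm_denominators_dvd_iff) auto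
  then obtain j where "j \<in> {1..n-1}" "real N * \<xi> j \<notin> \<int>"
    using assms(4) by blast
  then show ?thesis
  proof (rule star_discrepancy_ge_of_nonint_multiple[OF assms(1,2)])
    fix i assume "i \<in> {1..n}"
    then have "q i \<ge> 1" "\<xi> i = real (p i) / real (q i)"
      using weights by auto
    then show "q i > 0 \<and> real (q i) * \<xi> i \<in> \<int>"
      by simp
  qed
qed

lemma infinite_poorly_approximated_sizes_of_irrational_weight:
  assumes "i \<in> I" "\<And>k. k \<in> I \<Longrightarrow> i \<le> k" "\<xi> i \<notin> \<rat>" "c > 2"
  shows "infinite (poorly_approximated_sizes \<mu> c)"
proof -
  have "\<xi> i \<noteq> 1"
    using assms(3) by auto
  then obtain j where "j \<in> I" "measure \<mu> {0..<x j} = \<xi> i"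
    using exists_atom_above_first_weight assms(1,2) by blast
  then show ?thesis
    using infinite_poorly_approximated_sizes_of_irrational[OF finite_measure_axioms, of "x j"]
      atom_in_unit assms(3,4) by simp
qed

lemma infinite_poorly_approximated_sizes_of_positive_weights:
  assumes "i \<in> I" "\<And>k. k \<in> I \<Longrightarrow> i \<le> k" "\<xi> i > 0" and "j \<in> I" "j \<noteq> i" "\<xi> j > 0"
  shows "\<exists>c\<ge>2. infinite (poorly_approximated_sizes \<mu> c)"
proof -
  have "\<xi> i < 1"
    using sum_weights_le_1[of "{i, j}"] assms by simp
  then obtain k where "k \<in> I" "measure \<mu> {0..<x k} = \<xi> i"
    using exists_atom_above_first_weight[OF assms(1,2)] by auto
  moreover have "\<xi> i \<notin> \<int>"
    using Ints_nonzero_abs_less1[of "\<xi> i"] \<open>\<xi> i > 0\<close> \<open>\<xi> i < 1\<close> by auto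
  ultimately show ?thesis
    using infinite_poorly_approximated_sizes_of_nonint[OF finite_measure_axioms, of "x k"]
      atom_in_unit by simp
qed

end

lemmas ordered_dirac_sumI = ordered_dirac_sum.intro[OF _ ordered_dirac_sum_axioms.intro]

theorem theorem1p2:
  fixes \<mu> :: "real measure"
  assumes "prob_space \<mu>" and "sets \<mu> = sets unit_borel" and "discrete_measure \<mu>"
  shows
    "(\<forall>(n::nat) (\<xi>::nat \<Rightarrow> real) (x::nat \<Rightarrow> real) (p::nat \<Rightarrow> nat) (q::nat \<Rightarrow> nat) (N::nat).
        n \<ge> 1 \<and> N \<ge> 1 \<and>
        is_dirac_sum \<mu> {1..n} \<xi> x \<and>
        strict_mono_on {1..n} x \<and> (\<forall>i\<in>{1..n}. 0 \<le> x i \<and> x i \<le> 1) \<and>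
        (\<forall>i\<in>{1..n}. q i \<ge> 1 \<and> coprime (p i) (q i) \<and> \<xi> i = real (p i) / real (q i))
        \<longrightarrow>
        (Lcm (q ` {1..n-1}) dvd N \<longrightarrow>
           (\<exists>y. point_set N y \<and> star_discrepancy \<mu> (empirical_measure N y) = 0)) \<and>
        (\<not> Lcm (q ` {1..n-1}) dvd N \<longrightarrow>
           (\<forall>y. point_set N y \<longrightarrow>
              star_discrepancy \<mu> (empirical_measure N y)
                \<ge> 1 / (real (Max (q ` {1..n})) * real N))))
     \<and>
     (\<forall>(n::nat) (\<xi>::nat \<Rightarrow> real) (x::nat \<Rightarrow> real).
        n \<ge> 1 \<and>
        is_dirac_sum \<mu> {1..n} \<xi> x \<and>
        strict_mono_on {1..n} x \<and> (\<forall>i\<in>{1..n}. 0 \<le> x i \<and> x i \<le> 1) \<and>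
        (\<forall>i\<in>{1..n}. \<xi> i \<notin> \<rat>) \<and>
        (\<forall>l\<in>{1..n-1}. (\<Sum>i=1..l. \<xi> i) \<notin> \<rat>)
        \<longrightarrow>
        (\<forall>c>2. infinite {N. N \<ge> 1 \<and>
           (\<forall>y. point_set N y \<longrightarrow>
              star_discrepancy \<mu> (empirical_measure N y) \<ge> 1 / (c * real N))}))
     \<and>
     (\<forall>(\<xi>::nat \<Rightarrow> real) (x::nat \<Rightarrow> real).
        is_dirac_sum \<mu> {1..} \<xi> x \<and>
        (\<forall>i\<ge>1. 0 \<le> x i \<and> x i \<le> 1) \<and>
        (\<forall>i\<ge>1. x i < x (i + 1)) \<and> (\<forall>i\<ge>1. \<xi> i > 0)
        \<longrightarrow>
        (\<exists>c\<ge>2. infinite {N. N \<ge> 1 \<and>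
           (\<forall>y. point_set N y \<longrightarrow>
              star_discrepancy \<mu> (empirical_measure N y) \<ge> 1 / (c * real N))}) \<and>
        ((\<forall>l\<ge>1. (\<Sum>i=1..l. \<xi> i) \<notin> \<rat>) \<longrightarrow>
           (\<forall>c>2. infinite {N. N \<ge> 1 \<and>
              (\<forall>y. point_set N y \<longrightarrow>
                 star_discrepancy \<mu> (empirical_measure N y) \<ge> 1 / (c * real N))})))"
proof (fold poorly_approximated_sizes_def, intro conjI allI impI, goal_cases)
  case (1 n \<xi> x p q N)
  with assms interpret ordered_dirac_sum \<mu> "{1..n}" \<xi> x by (intro ordered_dirac_sumI) auto
  from 1 show ?case by (intro exists_zero_star_discrepancy_of_Lcm_dvd[where p = p]) auto
next
  case (2 n \<xi> x p q N y)
  with assms interpret ordered_dirac_sum \<mu> "{1..n}" \<xi> x by (intro ordered_dirac_sumI) auto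
  from 2 show ?case by (intro star_discrepancy_ge_of_not_Lcm_dvd[where p = p]) auto
next
  case (3 n \<xi> x c)
  with assms interpret ordered_dirac_sum \<mu> "{1..n}" \<xi> x by (intro ordered_dirac_sumI) auto
  from 3 show ?case
    by (intro infinite_poorly_approximated_sizes_of_irrational_weight[of 1]) auto
next
  case (4 \<xi> x)
  with assms interpret ordered_dirac_sum \<mu> "{1..}" \<xi> x
    by (intro ordered_dirac_sumI strict_mono_on_atLeastI) auto
  from 4 show ?case
    by (intro infinite_poorly_approximated_sizes_of_positive_weights[of 1 2]) auto
next
  case (5 \<xi> x c)
  with assms interpret ordered_dirac_sum \<mu> "{1..}" \<xi> x
    by (intro ordered_dirac_sumI strict_mono_on_atLeastI) auto
  from 5 show ?case
    by (intro infinite_poorly_approximated_sizes_of_irrational_weight[of 1])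
      (auto dest: spec[of _ 1])
qed

end
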